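(* The triple $(\mathbb{L}\mathrm{Vir},\partial,\int)$ of virtual linear species with their derivative and integral is an integro-differential ring (of weight $0$).
   Context: A linear species $F$ is a functor from the category of finite totally ordered sets with increasing bijections to finite sets; linear species are identified up to natural isomorphism. For totally ordered $\ell$: $(F+G)[\ell]=F[\ell]\sqcup G[\ell]$; $(FG)[\ell]=\bigsqcup_{\ell_1+\ell_2=\ell}F[\ell_1]\times G[\ell_2]$ (decompositions of the underlying set into two parts with the restricted orders); the derivative is $\partial F[\ell]=F[1\oplus\ell]$, where $1\oplus\ell$ adjoins a new minimum; the integral is $(\int F)[\ell]=\emptyset$ if $\ell=\emptyset$ and $F[\ell\setminus m_\ell]$ otherwise, $m_\ell$ the minimum of $\ell$. $\mathbb{L}\mathrm{Vir}$ is the ring of virtual linear species: formal differences $F-G$ of linear species modulo $F-G=H-K$ iff $F+K\cong G+H$, with sum, product, $\partial$ and $\int$ extended by additivity. An integro-differential ring (of weight $0$) is a commutative ring $R$ with an additive $\partial$ satisfying $\partial(xy)=\partial(x)y+x\partial(y)$ and an additive $\int$ with $\partial\int=\mathrm{id}_R$ and $\int\big(\partial(x)\int y\big)=x\int y-\int(xy)$ for all $x,y\in R$. *)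

theory Defs
  imports "HOL-Algebra.Ring" "HOL-Library.FSet" "HOL-Library.FuncSet"
begin

section \<open>Finite totally ordered sets and increasing bijections\<close>

text \<open>
  HOL has no type of all sets, so the elements of all finite sets, both of labels and of
  structures, are drawn from one universe. It contains arbitrary atoms and is closed under the
  constructions needed below: a one-point set (Pt), tagged copies for disjoint unions (InL, InR),
  and the elements (A1, A2, s, t) of a disjoint union over decompositions (Dec). The type of atoms
  is an arbitrary parameter. The universe is always infinite, so every finite totally ordered set
  and every finite set has an isomorphic copy in it.
\<close>

datatype 'a univ =
    Atom 'a
  | Pt
  | InL "'a univ"
  | InR "'a univ"
  | Dec "'a univ fset" "'a univ fset" "'a univ" "'a univ"

type_synonym 'a toset = "'a univ fset \<times> 'a univ rel"

definition points :: "'a toset \<Rightarrow> 'a univ set" where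
  "points l = fset (fst l)"

definition is_toset :: "'a toset \<Rightarrow> bool" where
  "is_toset l \<longleftrightarrow> linear_order_on (points l) (snd l)"

text \<open>
  Morphisms are functions that are extensional on their domain, so that two functions that agree
  on the underlying set are the same morphism. Identities are restrictions of the identity, and
  composition is the constant compose of the function set library.
\<close>

definition toset_hom :: "'a toset \<Rightarrow> 'a toset \<Rightarrow> ('a univ \<Rightarrow> 'a univ) set" where
  "toset_hom l l' =
     {\<sigma> \<in> points l \<rightarrow>\<^sub>E points l'.
        bij_betw \<sigma> (points l) (points l') \<and>
        (\<forall>x\<in>points l. \<forall>y\<in>points l. (x, y) \<in> snd l \<longrightarrow> (\<sigma> x, \<sigma> y) \<in> snd l')}"

definition subtoset :: "'a toset \<Rightarrow> 'a univ fset \<Rightarrow> 'a toset" where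
  "subtoset l B = (B, snd l \<inter> fset B \<times> fset B)"

definition toset_min :: "'a toset \<Rightarrow> 'a univ" where
  "toset_min l = (THE m. m \<in> points l \<and> (\<forall>x\<in>points l. (m, x) \<in> snd l))"

definition remove_min :: "'a toset \<Rightarrow> 'a toset" where
  "remove_min l = subtoset l (fst l |-| {|toset_min l|})"

text \<open>The ordinal sum of a point with l: the new minimum is InL Pt, and l is relabelled by InR.\<close>

definition add_min :: "'a toset \<Rightarrow> 'a toset" where
  "add_min l =
     (finsert (InL Pt) (InR |`| fst l),
      {(InL Pt, y) | y. y \<in> insert (InL Pt) (InR ` points l)} \<union>
      {(InR x, InR y) | x y. (x, y) \<in> snd l})"

definition add_min_map :: "'a toset \<Rightarrow> ('a univ \<Rightarrow> 'a univ) \<Rightarrow> 'a univ \<Rightarrow> 'a univ" where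
  "add_min_map l \<sigma> =
     (\<lambda>z\<in>points (add_min l). case z of InR x \<Rightarrow> InR (\<sigma> x) | _ \<Rightarrow> InL Pt)"


section \<open>Linear species\<close>

text \<open>
  obj F l is the set F[l], and arr F l l' s is the map F[s] for a morphism s from l to l'.
  The values outside finite totally ordered sets, their morphisms and F[l] are irrelevant; they
  are ignored by functoriality and by natural isomorphism.
\<close>

record 'a species =
  obj :: "'a toset \<Rightarrow> 'a univ set"
  arr :: "'a toset \<Rightarrow> 'a toset \<Rightarrow> ('a univ \<Rightarrow> 'a univ) \<Rightarrow> 'a univ \<Rightarrow> 'a univ"

definition is_species :: "'a species \<Rightarrow> bool" where
  "is_species F \<longleftrightarrow>
     (\<forall>l. is_toset l \<longrightarrow> finite (obj F l)) \<and>
     (\<forall>l l' \<sigma>. is_toset l \<longrightarrow> is_toset l' \<longrightarrow> \<sigma> \<in> toset_hom l l' \<longrightarrow>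
        arr F l l' \<sigma> \<in> obj F l \<rightarrow> obj F l') \<and>
     (\<forall>l. is_toset l \<longrightarrow> (\<forall>s\<in>obj F l. arr F l l (\<lambda>x\<in>points l. x) s = s)) \<and>
     (\<forall>l l' l'' \<sigma> \<tau>. is_toset l \<longrightarrow> is_toset l' \<longrightarrow> is_toset l'' \<longrightarrow>
        \<sigma> \<in> toset_hom l l' \<longrightarrow> \<tau> \<in> toset_hom l' l'' \<longrightarrow>
        (\<forall>s\<in>obj F l.
           arr F l l'' (compose (points l) \<tau> \<sigma>) s = arr F l' l'' \<tau> (arr F l l' \<sigma> s)))"

definition species_iso :: "'a species \<Rightarrow> 'a species \<Rightarrow> bool"  (infix \<open>\<cong>\<^sub>S\<close> 50) where
  "F \<cong>\<^sub>S G \<longleftrightarrow>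
     (\<exists>\<eta>. (\<forall>l. is_toset l \<longrightarrow> bij_betw (\<eta> l) (obj F l) (obj G l)) \<and>
          (\<forall>l l' \<sigma>. is_toset l \<longrightarrow> is_toset l' \<longrightarrow> \<sigma> \<in> toset_hom l l' \<longrightarrow>
             (\<forall>s\<in>obj F l. \<eta> l' (arr F l l' \<sigma> s) = arr G l l' \<sigma> (\<eta> l s))))"

definition szero :: "'a species" where
  "szero = \<lparr>obj = (\<lambda>l. {}), arr = (\<lambda>l l' \<sigma> s. s)\<rparr>"

definition sone :: "'a species" where
  "sone = \<lparr>obj = (\<lambda>l. if points l = {} then {Pt} else {}), arr = (\<lambda>l l' \<sigma> s. s)\<rparr>"

definition splus :: "'a species \<Rightarrow> 'a species \<Rightarrow> 'a species"  (infixl \<open>+\<^sub>S\<close> 65) where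
  "F +\<^sub>S G =
     \<lparr>obj = (\<lambda>l. InL ` obj F l \<union> InR ` obj G l),
      arr = (\<lambda>l l' \<sigma> s. case s of InL u \<Rightarrow> InL (arr F l l' \<sigma> u)
                                 | InR u \<Rightarrow> InR (arr G l l' \<sigma> u)
                                 | _ \<Rightarrow> s)\<rparr>"

definition stimes :: "'a species \<Rightarrow> 'a species \<Rightarrow> 'a species"  (infixl \<open>*\<^sub>S\<close> 70) where
  "F *\<^sub>S G =
     \<lparr>obj = (\<lambda>l. {Dec A B s t | A B s t.
                    A |\<union>| B = fst l \<and> A |\<inter>| B = {||} \<and>
                    s \<in> obj F (subtoset l A) \<and> t \<in> obj G (subtoset l B)}),
      arr = (\<lambda>l l' \<sigma> u. case u of
                Dec A B s t \<Rightarrow>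
                  Dec (\<sigma> |`| A) (\<sigma> |`| B)
                    (arr F (subtoset l A) (subtoset l' (\<sigma> |`| A)) (restrict \<sigma> (fset A)) s)
                    (arr G (subtoset l B) (subtoset l' (\<sigma> |`| B)) (restrict \<sigma> (fset B)) t)
              | _ \<Rightarrow> u)\<rparr>"

definition sderiv :: "'a species \<Rightarrow> 'a species" where
  "sderiv F =
     \<lparr>obj = (\<lambda>l. obj F (add_min l)),
      arr = (\<lambda>l l' \<sigma>. arr F (add_min l) (add_min l') (add_min_map l \<sigma>))\<rparr>"

definition sint :: "'a species \<Rightarrow> 'a species" where
  "sint F =
     \<lparr>obj = (\<lambda>l. if points l = {} then {} else obj F (remove_min l)),
      arr = (\<lambda>l l' \<sigma>. arr F (remove_min l) (remove_min l')
                              (restrict \<sigma> (points (remove_min l))))\<rparr>"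


section \<open>Virtual linear species\<close>

type_synonym 'a virtual = "('a species \<times> 'a species) set"

definition virtual_rel :: "(('a species \<times> 'a species) \<times> ('a species \<times> 'a species)) set" where
  "virtual_rel =
     {((F, G), (H, K)) | F G H K.
        is_species F \<and> is_species G \<and> is_species H \<and> is_species K \<and> F +\<^sub>S K \<cong>\<^sub>S G +\<^sub>S H}"

text \<open>The formal difference F - G.\<close>

definition vdiff :: "'a species \<Rightarrow> 'a species \<Rightarrow> 'a virtual" where
  "vdiff F G = virtual_rel `` {(F, G)}"

text \<open>
  The operations take the union of the resulting classes over all representatives. If two
  representatives gave different classes, this union would not be a class, so closure of the
  carrier under the operations includes well-definedness.
\<close>

definition LVir :: "'a virtual ring" where
  "LVir =
     \<lparr>carrier = ({F. is_species F} \<times> {G. is_species G}) // virtual_rel,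
      mult = (\<lambda>X Y. \<Union>(F, G)\<in>X. \<Union>(H, K)\<in>Y. vdiff (F *\<^sub>S H +\<^sub>S G *\<^sub>S K) (F *\<^sub>S K +\<^sub>S G *\<^sub>S H)),
      one = vdiff sone szero,
      zero = vdiff szero szero,
      add = (\<lambda>X Y. \<Union>(F, G)\<in>X. \<Union>(H, K)\<in>Y. vdiff (F +\<^sub>S H) (G +\<^sub>S K))\<rparr>"

definition vderiv :: "'a virtual \<Rightarrow> 'a virtual" where
  "vderiv X = (\<Union>(F, G)\<in>X. vdiff (sderiv F) (sderiv G))"

definition vint :: "'a virtual \<Rightarrow> 'a virtual" where
  "vint X = (\<Union>(F, G)\<in>X. vdiff (sint F) (sint G))"


section \<open>Integro-differential rings of weight 0\<close>

locale integro_differential_ring = cring R for R (structure) +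
  fixes D :: "'a \<Rightarrow> 'a" and J :: "'a \<Rightarrow> 'a"
  assumes D_closed: "x \<in> carrier R \<Longrightarrow> D x \<in> carrier R"
    and J_closed: "x \<in> carrier R \<Longrightarrow> J x \<in> carrier R"
    and D_add: "\<lbrakk>x \<in> carrier R; y \<in> carrier R\<rbrakk> \<Longrightarrow> D (x \<oplus> y) = D x \<oplus> D y"
    and J_add: "\<lbrakk>x \<in> carrier R; y \<in> carrier R\<rbrakk> \<Longrightarrow> J (x \<oplus> y) = J x \<oplus> J y"
    and Leibniz: "\<lbrakk>x \<in> carrier R; y \<in> carrier R\<rbrakk> \<Longrightarrow> D (x \<otimes> y) = D x \<otimes> y \<oplus> x \<otimes> D y"
    and D_J: "x \<in> carrier R \<Longrightarrow> D (J x) = x"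
    and by_parts: "\<lbrakk>x \<in> carrier R; y \<in> carrier R\<rbrakk> \<Longrightarrow>
          J (D x \<otimes> J y) = x \<otimes> J y \<ominus> J (x \<otimes> y)"

end

theory Submission
  imports Defs "HOL-Computational_Algebra.Formal_Power_Series"
begin

text \<open>
  Between two finite totally ordered sets of the same size there is exactly one increasing
  bijection, so a linear species is determined up to isomorphism by the numbers of its structures
  on n points. Hence sending F - G to the difference of the exponential generating series embeds
  the virtual linear species into the formal power series over the rationals, and turns the
  derivative and the integral of species into those of power series, where all identities are
  classical.
\<close>


section \<open>Rigidity of finite totally ordered sets\<close>

text \<open>Counts decide isomorphism only for genuine functors, so every operation must first be
  shown to preserve functoriality. Dividing the counts by n! serves two ends: a shift of counts
  becomes the formal derivative or integral, and the binomial convolution of counts, caused by the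
  free choice of the first part of a decomposition, becomes the Cauchy product. The embedding is not
  onto, since n! times the n-th coefficient of an image is an integer. Hence only equations are
  pulled back from power series; closure and additive inverses must come from species. The ring
  operations are unions over all representatives, so they must first be computed on formal
  differences, and series also settle the independence of representatives.\<close>

lemma toset_refl: "is_toset l \<Longrightarrow> x \<in> points l \<Longrightarrow> (x, x) \<in> snd l"
  by (auto simp: is_toset_def order_on_defs refl_on_def)

lemma toset_trans: "is_toset l \<Longrightarrow> (x, y) \<in> snd l \<Longrightarrow> (y, z) \<in> snd l \<Longrightarrow> (x, z) \<in> snd l"
  by (auto simp: is_toset_def order_on_defs dest: transD)

lemma toset_antisym: "is_toset l \<Longrightarrow> (x, y) \<in> snd l \<Longrightarrow> (y, x) \<in> snd l \<Longrightarrow> x = y"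
  by (auto simp: is_toset_def order_on_defs dest: antisymD)

lemma toset_total:
  "is_toset l \<Longrightarrow> x \<in> points l \<Longrightarrow> y \<in> points l \<Longrightarrow> (x, y) \<in> snd l \<or> (y, x) \<in> snd l"
  by (cases "x = y") (auto simp: is_toset_def order_on_defs total_on_def refl_on_def)

lemma toset_field: "is_toset l \<Longrightarrow> (x, y) \<in> snd l \<Longrightarrow> x \<in> points l \<and> y \<in> points l"
  by (auto simp: is_toset_def order_on_defs)

lemma is_tosetI:
  assumes "\<And>x y. (x, y) \<in> snd l \<Longrightarrow> x \<in> points l \<and> y \<in> points l"
    and "\<And>x. x \<in> points l \<Longrightarrow> (x, x) \<in> snd l"
    and "\<And>x y z. (x, y) \<in> snd l \<Longrightarrow> (y, z) \<in> snd l \<Longrightarrow> (x, z) \<in> snd l"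
    and "\<And>x y. (x, y) \<in> snd l \<Longrightarrow> (y, x) \<in> snd l \<Longrightarrow> x = y"
    and "\<And>x y. x \<in> points l \<Longrightarrow> y \<in> points l \<Longrightarrow> (x, y) \<in> snd l \<or> (y, x) \<in> snd l"
  shows "is_toset l"
  unfolding is_toset_def order_on_defs refl_on_def trans_def antisym_def total_on_def
  using assms by (auto 4 4 simp: subset_iff)

lemma finite_points [simp]: "finite (points l)"
  by (simp add: points_def)

text \<open>Numbers the points of a finite total order from 0 in increasing order. Morphisms
  preserve this number, which yields both their uniqueness and their existence.\<close>

definition rank :: "'a toset \<Rightarrow> 'a univ \<Rightarrow> nat" where
  "rank l x = card {y \<in> points l. (y, x) \<in> snd l \<and> y \<noteq> x}"

lemma rank_less:
  assumes "is_toset l" "(x, y) \<in> snd l" "x \<noteq> y"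
  shows "rank l x < rank l y"
proof -
  have "{z \<in> points l. (z, x) \<in> snd l \<and> z \<noteq> x} \<subset> {z \<in> points l. (z, y) \<in> snd l \<and> z \<noteq> y}"
    using assms(2,3) toset_trans[OF assms(1) _ assms(2)] toset_antisym[OF assms(1,2)]
      toset_field[OF assms(1,2)]
    by auto
  then show ?thesis
    by (simp add: rank_def psubset_card_mono)
qed

lemma rank_le_iff:
  assumes "is_toset l" "x \<in> points l" "y \<in> points l"
  shows "rank l x \<le> rank l y \<longleftrightarrow> (x, y) \<in> snd l"
proof (cases "x = y")
  case False
  then show ?thesis
    using rank_less[OF assms(1), of x y] rank_less[OF assms(1), of y x] toset_total[OF assms]
      toset_antisym[OF assms(1), of x y] by auto
qed (use assms toset_refl[OF assms(1)] in auto)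

lemma inj_on_rank: "is_toset l \<Longrightarrow> inj_on (rank l) (points l)"
  by (intro inj_onI) (metis order_refl rank_le_iff toset_antisym)

lemma bij_betw_rank:
  assumes "is_toset l"
  shows "bij_betw (rank l) (points l) {..<card (points l)}"
proof -
  have "rank l x < card (points l)" if "x \<in> points l" for x
    unfolding rank_def using that by (intro psubset_card_mono) auto
  then have "rank l ` points l = {..<card (points l)}"
    by (intro card_subset_eq) (auto simp: card_image inj_on_rank assms)
  then show ?thesis
    by (simp add: bij_betw_def inj_on_rank assms)
qed

lemma toset_homD:
  assumes "\<sigma> \<in> toset_hom l l'"
  shows "bij_betw \<sigma> (points l) (points l')" "inj_on \<sigma> (points l)" "\<sigma> ` points l = points l'"
    "\<sigma> \<in> extensional (points l)" "\<And>x. x \<in> points l \<Longrightarrow> \<sigma> x \<in> points l'"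
    "\<And>x y. x \<in> points l \<Longrightarrow> y \<in> points l \<Longrightarrow> (x, y) \<in> snd l \<Longrightarrow> (\<sigma> x, \<sigma> y) \<in> snd l'"
  using assms by (auto simp: toset_hom_def bij_betw_def PiE_def)

lemma toset_homI:
  assumes "inj_on \<sigma> (points l)" "\<sigma> ` points l = points l'" "\<sigma> \<in> extensional (points l)"
    "\<And>x y. x \<in> points l \<Longrightarrow> y \<in> points l \<Longrightarrow> (x, y) \<in> snd l \<Longrightarrow> (\<sigma> x, \<sigma> y) \<in> snd l'"
  shows "\<sigma> \<in> toset_hom l l'"
  using assms by (auto simp: toset_hom_def bij_betw_def PiE_def)

text \<open>By totality the only alternative is \<open>(y, x)\<close> in the order; then
  antisymmetry gives equal images, and injectivity gives equal points.\<close>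

lemma toset_hom_reflect:
  assumes "is_toset l" "is_toset l'" "\<sigma> \<in> toset_hom l l'"
    and "x \<in> points l" "y \<in> points l" "(\<sigma> x, \<sigma> y) \<in> snd l'"
  shows "(x, y) \<in> snd l"
  using toset_total[OF assms(1,4,5)] toset_homD(6)[OF assms(3), of y x]
    toset_antisym[OF assms(2,6)] toset_homD(2)[OF assms(3)] assms
  by (metis inj_on_contraD toset_refl)

text \<open>A morphism maps the strict predecessors of \<open>x\<close> bijectively onto those of
  its image.\<close>

lemma rank_toset_hom:
  assumes "is_toset l" "is_toset l'" "\<sigma> \<in> toset_hom l l'" "x \<in> points l"
  shows "rank l' (\<sigma> x) = rank l x"
proof -
  have "(\<sigma> y, \<sigma> x) \<in> snd l' \<and> \<sigma> y \<noteq> \<sigma> x \<longleftrightarrow> (y, x) \<in> snd l \<and> y \<noteq> x" if "y \<in> points l" for y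
    using that toset_homD(2,6)[OF assms(3)] toset_hom_reflect[OF assms(1-3)] assms(4)
    by (metis inj_onD)
  then have "{y \<in> points l'. (y, \<sigma> x) \<in> snd l' \<and> y \<noteq> \<sigma> x}
      = \<sigma> ` {y \<in> points l. (y, x) \<in> snd l \<and> y \<noteq> x}"
    by (auto simp flip: toset_homD(3)[OF assms(3)])
  moreover have "inj_on \<sigma> {y \<in> points l. (y, x) \<in> snd l \<and> y \<noteq> x}"
    using toset_homD(2)[OF assms(3)] by (rule inj_on_subset) auto
  ultimately show ?thesis
    by (simp add: rank_def card_image)
qed

text \<open>Both images of a point have its rank, and ranks are injective on the target. Agreement
  on points is equality because morphisms are extensional.\<close>

lemma toset_hom_unique:
  assumes "is_toset l" "is_toset l'" "\<sigma> \<in> toset_hom l l'" "\<tau> \<in> toset_hom l l'"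
  shows "\<sigma> = \<tau>"
proof (rule extensionalityI)
  fix x assume x: "x \<in> points l"
  show "\<sigma> x = \<tau> x"
    using inj_on_rank[OF assms(2)]
    by (rule inj_onD)
      (use x assms in \<open>simp_all add: rank_toset_hom toset_homD\<close>)
qed (rule toset_homD(4)[OF assms(3)], rule toset_homD(4)[OF assms(4)])

lemma toset_hom_id: "(\<lambda>x\<in>points l. x) \<in> toset_hom l l"
  by (rule toset_homI) (auto simp: inj_on_def)

lemma toset_hom_compose:
  assumes "\<sigma> \<in> toset_hom l l'" "\<tau> \<in> toset_hom l' l''"
  shows "compose (points l) \<tau> \<sigma> \<in> toset_hom l l''"
proof (rule toset_homI)
  show "inj_on (compose (points l) \<tau> \<sigma>) (points l)"
    using toset_homD[OF assms(1)] toset_homD[OF assms(2)]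
    by (auto simp: inj_on_def compose_def)
  have "compose (points l) \<tau> \<sigma> ` points l = \<tau> ` \<sigma> ` points l"
    by (simp add: compose_def image_image)
  then show "compose (points l) \<tau> \<sigma> ` points l = points l''"
    by (simp add: toset_homD(3)[OF assms(1)] toset_homD(3)[OF assms(2)])
qed (use toset_homD[OF assms(1)] toset_homD[OF assms(2)] in \<open>auto simp: compose_def\<close>)

lemma toset_hom_card: "\<sigma> \<in> toset_hom l l' \<Longrightarrow> card (points l) = card (points l')"
  using toset_homD(1) bij_betw_same_card by blast

lemma toset_hom_exists:
  assumes "is_toset l" "is_toset l'" "card (points l) = card (points l')"
  shows "\<exists>\<sigma>. \<sigma> \<in> toset_hom l l'"
proof
  \<comment> \<open>Each point goes to the point of the same rank; equal cardinalities make the two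
    ranges of ranks coincide.\<close>
  let ?\<sigma> = "restrict (inv_into (points l') (rank l') \<circ> rank l) (points l)"
  have bij: "bij_betw (inv_into (points l') (rank l') \<circ> rank l) (points l) (points l')"
    using bij_betw_rank[OF assms(1)] bij_betw_inv_into[OF bij_betw_rank[OF assms(2)]] assms(3)
    by (auto intro: bij_betw_trans)
  have rk: "rank l' (?\<sigma> x) = rank l x" if "x \<in> points l" for x
    using that bij_betw_rank[OF assms(1)] bij_betw_rank[OF assms(2)] assms(3)
    by (auto simp: bij_betw_def intro!: f_inv_into_f)
  have "bij_betw ?\<sigma> (points l) (points l')"
    using bij by (simp cong: bij_betw_cong)
  then show "?\<sigma> \<in> toset_hom l l'"
  proof (intro toset_homI)
    fix x y assume "bij_betw ?\<sigma> (points l) (points l')" and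
      xy: "x \<in> points l" "y \<in> points l" "(x, y) \<in> snd l"
    then have "?\<sigma> x \<in> points l'" "?\<sigma> y \<in> points l'"
      by (metis bij_betwE)+
    moreover have "rank l' (?\<sigma> x) \<le> rank l' (?\<sigma> y)"
      using xy by (simp only: rk rank_le_iff[OF assms(1)])
    ultimately show "(?\<sigma> x, ?\<sigma> y) \<in> snd l'"
      by (simp only: rank_le_iff[OF assms(2)])
  qed (auto simp: bij_betw_def)
qed

section \<open>Suborders, adjoining a minimum and removing the minimum\<close>

lemma points_subtoset [simp]: "points (subtoset l A) = fset A"
  by (simp add: points_def subtoset_def)

lemma is_toset_subtoset:
  assumes "is_toset l" "fset A \<subseteq> points l"
  shows "is_toset (subtoset l A)"
proof (rule is_tosetI)
  fix x y assume "x \<in> points (subtoset l A)" "y \<in> points (subtoset l A)"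
  then show "(x, y) \<in> snd (subtoset l A) \<or> (y, x) \<in> snd (subtoset l A)"
    using assms(2) toset_total[OF assms(1), of x y] by (auto simp: subtoset_def points_def)
next
  fix x y z assume "(x, y) \<in> snd (subtoset l A)" "(y, z) \<in> snd (subtoset l A)"
  then show "(x, z) \<in> snd (subtoset l A)"
    using toset_trans[OF assms(1), of x y z] by (auto simp: subtoset_def)
qed (use assms toset_refl[OF assms(1)] toset_antisym[OF assms(1)] in
    \<open>auto simp: subtoset_def points_def subset_iff\<close>)

lemma toset_hom_restrict:
  assumes "\<sigma> \<in> toset_hom l l'" "fset A \<subseteq> points l"
  shows "restrict \<sigma> (fset A) \<in> toset_hom (subtoset l A) (subtoset l' (\<sigma> |`| A))"
  using toset_homD[OF assms(1)] assms(2)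
  by (intro toset_homI) (auto simp: subtoset_def inj_on_def points_def subset_iff)

lemma points_add_min: "points (add_min l) = insert (InL Pt) (InR ` points l)"
  by (simp add: points_def add_min_def)

lemma snd_add_min:
  "(u, v) \<in> snd (add_min l) \<longleftrightarrow>
     u = InL Pt \<and> v \<in> points (add_min l) \<or> (\<exists>x y. u = InR x \<and> v = InR y \<and> (x, y) \<in> snd l)"
  by (auto simp: points_def add_min_def)

lemma card_points_add_min: "card (points (add_min l)) = Suc (card (points l))"
  by (auto simp: points_add_min card_insert_if card_image inj_on_def)

lemma is_toset_add_min:
  assumes "is_toset l"
  shows "is_toset (add_min l)"
proof (rule is_tosetI)
  fix x y assume "x \<in> points (add_min l)" "y \<in> points (add_min l)"
  then show "(x, y) \<in> snd (add_min l) \<or> (y, x) \<in> snd (add_min l)"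
    by (auto simp: snd_add_min points_add_min dest: toset_total[OF assms])
qed (auto simp: snd_add_min points_add_min
    dest: toset_field[OF assms] toset_antisym[OF assms]
    intro: toset_refl[OF assms] toset_trans[OF assms])

lemma toset_hom_add_min:
  assumes "\<sigma> \<in> toset_hom l l'"
  shows "add_min_map l \<sigma> \<in> toset_hom (add_min l) (add_min l')"
proof (rule toset_homI)
  show "add_min_map l \<sigma> ` points (add_min l) = points (add_min l')"
    unfolding add_min_map_def points_add_min image_insert image_restrict_eq
    by (simp add: image_image flip: toset_homD(3)[OF assms])
qed (use toset_homD[OF assms] in
    \<open>auto simp: add_min_map_def points_add_min snd_add_min inj_on_def\<close>)

lemma toset_min_eqI:
  assumes "is_toset l" "m \<in> points l" "\<And>x. x \<in> points l \<Longrightarrow> (m, x) \<in> snd l"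
  shows "toset_min l = m"
  unfolding toset_min_def using assms toset_antisym by blast

lemma toset_min:
  assumes "is_toset l" "points l \<noteq> {}"
  shows "toset_min l \<in> points l" "\<And>x. x \<in> points l \<Longrightarrow> (toset_min l, x) \<in> snd l"
proof -
  \<comment> \<open>The ranks fill an initial segment of the naturals, so some point has rank 0;
    comparing ranks shows that it lies below every other point.\<close>
  have "0 \<in> rank l ` points l"
    using bij_betw_rank[OF assms(1)] assms(2) by (auto simp: bij_betw_def card_gt_0_iff)
  then obtain m where m: "m \<in> points l" "rank l m = 0"
    by auto
  then have "(m, x) \<in> snd l" if "x \<in> points l" for x
    using rank_le_iff[OF assms(1) m(1) that] by simp
  with m toset_min_eqI[OF assms(1)] have "toset_min l = m"
    by blast
  with m \<open>\<And>x. x \<in> points l \<Longrightarrow> (m, x) \<in> snd l\<close>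
  show "toset_min l \<in> points l" "\<And>x. x \<in> points l \<Longrightarrow> (toset_min l, x) \<in> snd l"
    by auto
qed

lemma points_remove_min: "points (remove_min l) = points l - {toset_min l}"
  by (simp add: remove_min_def points_def subtoset_def)

lemma is_toset_remove_min: "is_toset l \<Longrightarrow> is_toset (remove_min l)"
  unfolding remove_min_def by (rule is_toset_subtoset) (auto simp: points_def)

lemma card_points_remove_min:
  "is_toset l \<Longrightarrow> points l \<noteq> {} \<Longrightarrow> card (points (remove_min l)) = card (points l) - 1"
  by (simp add: points_remove_min toset_min)

lemma toset_hom_min:
  assumes "is_toset l" "is_toset l'" "\<sigma> \<in> toset_hom l l'" "points l \<noteq> {}"
  shows "toset_min l' = \<sigma> (toset_min l)"
proof (rule toset_min_eqI[OF assms(2)])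
  show "(\<sigma> (toset_min l), y) \<in> snd l'" if "y \<in> points l'" for y
    using that toset_homD(6)[OF assms(3) toset_min(1)[OF assms(1,4)]] toset_min(2)[OF assms(1,4)]
    by (auto simp flip: toset_homD(3)[OF assms(3)])
qed (rule toset_homD(5)[OF assms(3) toset_min(1)[OF assms(1,4)]])

text \<open>A morphism carries minimum to minimum and is injective, so it maps one complement onto
  the other.\<close>

lemma toset_hom_remove_min:
  assumes "is_toset l" "is_toset l'" "\<sigma> \<in> toset_hom l l'" "points l \<noteq> {}"
  shows "restrict \<sigma> (points (remove_min l)) \<in> toset_hom (remove_min l) (remove_min l')"
proof -
  let ?A = "fst l |-| {|toset_min l|}"
  have "\<sigma> ` (points l - {toset_min l}) = points l' - {toset_min l'}"
    using toset_homD[OF assms(3)] toset_min(1)[OF assms(1,4)] toset_hom_min[OF assms]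
    by (subst inj_on_image_set_diff[OF toset_homD(2)[OF assms(3)]]) auto
  then have "\<sigma> |`| ?A = fst l' |-| {|toset_min l'|}"
    by (simp add: fset_eq_iff points_def flip: fset_inject)
  moreover have "fset ?A \<subseteq> points l"
    by (auto simp: points_def)
  ultimately show ?thesis
    using toset_hom_restrict[OF assms(3), of ?A] by (simp add: remove_min_def)
qed

text \<open>Iterating \<open>add_min\<close> makes the derivative at n by definition the species at
  n + 1, so \<open>scard_sderiv\<close> is mere unfolding.\<close>

primrec std_toset :: "nat \<Rightarrow> 'a toset" where
  "std_toset 0 = ({||}, {})"
| "std_toset (Suc n) = add_min (std_toset n)"

lemma is_toset_std [simp]: "is_toset (std_toset n)"
  by (induction n) (auto simp: is_toset_add_min points_def intro: is_tosetI)

lemma card_std [simp]: "card (points (std_toset n)) = n"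
  by (induction n) (simp_all add: card_points_add_min, simp add: points_def)

lemma points_std_empty_iff: "points (std_toset n) = {} \<longleftrightarrow> n = 0"
  by (metis card_0_eq card_std finite_points)


section \<open>Linear species are determined by their cardinalities\<close>

lemma species_finite: "is_species F \<Longrightarrow> is_toset l \<Longrightarrow> finite (obj F l)"
  unfolding is_species_def by blast

lemma species_arr_in:
  "is_species F \<Longrightarrow> is_toset l \<Longrightarrow> is_toset l' \<Longrightarrow> \<sigma> \<in> toset_hom l l' \<Longrightarrow> s \<in> obj F l \<Longrightarrow>
    arr F l l' \<sigma> s \<in> obj F l'"
  unfolding is_species_def by blast

text \<open>Rigidity allows an arbitrary endomorphism in place of the literal identity.\<close>

lemma species_arr_id:
  assumes "is_species F" "is_toset l" "\<sigma> \<in> toset_hom l l" "s \<in> obj F l"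
  shows "arr F l l \<sigma> s = s"
  using assms toset_hom_unique[OF assms(2,2,3) toset_hom_id]
  by (simp add: is_species_def del: split_paired_All)

text \<open>Any third side \<open>\<rho>\<close> of the triangle equals the composite by rigidity,
  so composites of transported maps never have to be computed.\<close>

lemma species_arr_comp:
  assumes "is_species F" "is_toset l" "is_toset l'" "is_toset l''"
    and "\<sigma> \<in> toset_hom l l'" "\<tau> \<in> toset_hom l' l''" "\<rho> \<in> toset_hom l l''" "s \<in> obj F l"
  shows "arr F l' l'' \<tau> (arr F l l' \<sigma> s) = arr F l l'' \<rho> s"
  using assms toset_hom_unique[OF assms(2,4,7) toset_hom_compose[OF assms(5,6)]]
  unfolding is_species_def by metis

text \<open>A morphism in the other direction exists by cardinality, and both round trips are
  endomorphisms, hence act as identities.\<close>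

lemma species_arr_bij:
  assumes "is_species F" "is_toset l" "is_toset l'" "\<sigma> \<in> toset_hom l l'"
  shows "bij_betw (arr F l l' \<sigma>) (obj F l) (obj F l')"
proof -
  obtain \<tau> where \<tau>: "\<tau> \<in> toset_hom l' l"
    using toset_hom_exists assms toset_hom_card by metis
  have inv: "arr F m' m \<beta> (arr F m m' \<alpha> s) = s"
    if "is_toset m" "is_toset m'" "\<alpha> \<in> toset_hom m m'" "\<beta> \<in> toset_hom m' m" "s \<in> obj F m"
    for m m' \<alpha> \<beta> s
    using species_arr_comp[OF assms(1) that(1,2,1,3,4) toset_hom_id that(5)]
      species_arr_id[OF assms(1) that(1) toset_hom_id that(5)] by simp
  show ?thesis
    by (rule bij_betw_byWitness[where f' = "arr F l' l \<tau>"])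
      (use assms(2-4) \<tau> inv species_arr_in[OF assms(1)] in blast)+
qed

definition scard :: "'a species \<Rightarrow> nat \<Rightarrow> nat" where
  "scard F n = card (obj F (std_toset n))"

lemma card_obj:
  assumes "is_species F" "is_toset l"
  shows "card (obj F l) = scard F (card (points l))"
proof -
  obtain \<sigma> where "\<sigma> \<in> toset_hom l (std_toset (card (points l)))"
    using toset_hom_exists[OF assms(2) is_toset_std] by (metis card_std)
  then show ?thesis
    unfolding scard_def using species_arr_bij assms is_toset_std bij_betw_same_card by blast
qed

text \<open>A bijection on each standard set extends to a natural isomorphism because there is exactly
  one morphism between two totally ordered sets of the same size.\<close>

lemma species_iso_iff_scard:
  assumes "is_species F" "is_species G"
  shows "F \<cong>\<^sub>S G \<longleftrightarrow> scard F = scard G"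
proof
  assume "F \<cong>\<^sub>S G"
  then show "scard F = scard G"
    unfolding species_iso_def scard_def by (metis bij_betw_same_card is_toset_std)
next
  assume eq: "scard F = scard G"
  have "\<exists>b. bij_betw b (obj F (std_toset n)) (obj G (std_toset n))" for n
    using fun_cong[OF eq, of n] assms
    by (intro finite_same_card_bij) (auto simp: scard_def species_finite)
  then obtain b where b: "\<And>n. bij_betw (b n) (obj F (std_toset n)) (obj G (std_toset n))"
    by metis
  define S :: "'a toset \<Rightarrow> 'a toset" where "S l = std_toset (card (points l))" for l
  have S: "is_toset (S l)" "card (points (S l)) = card (points l)" for l
    by (simp_all add: S_def)
  have "\<exists>\<sigma>. \<sigma> \<in> toset_hom l (S l)" "\<exists>\<tau>. \<tau> \<in> toset_hom (S l) l" if "is_toset l" for l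
    using toset_hom_exists[OF that S(1)] toset_hom_exists[OF S(1) that] S(2) by metis+
  then obtain p q where p: "\<And>l. is_toset l \<Longrightarrow> p l \<in> toset_hom l (S l)"
    and q: "\<And>l. is_toset l \<Longrightarrow> q l \<in> toset_hom (S l) l"
    by metis
  \<comment> \<open>Transport to the standard copy, apply the bijection chosen there, and transport
    back.\<close>
  let ?\<eta> = "\<lambda>l. arr G (S l) l (q l) \<circ> (b (card (points l)) \<circ> arr F l (S l) (p l))"
  have bS: "bij_betw (b (card (points l))) (obj F (S l)) (obj G (S l))" for l
    by (simp add: S_def b)
  show "F \<cong>\<^sub>S G"
    unfolding species_iso_def
  proof (rule exI[of _ ?\<eta>], intro conjI allI impI ballI)
    fix l :: "'a toset" assume l: "is_toset l"
    show "bij_betw (?\<eta> l) (obj F l) (obj G l)"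
      using species_arr_bij[OF assms(1) l S(1) p[OF l]] bS[of l]
        species_arr_bij[OF assms(2) S(1) l q[OF l]]
      by (blast intro: bij_betw_trans)
  next
    fix l l' :: "'a toset" and \<sigma> s
    assume l: "is_toset l" "is_toset l'" and \<sigma>: "\<sigma> \<in> toset_hom l l'" and s: "s \<in> obj F l"
    \<comment> \<open>Both sets share their standard copy and hence the bijection \<open>b\<close>.
      Naturality reduces to two triangles of morphisms, one for \<open>F\<close> through
      \<open>p\<close> and one for \<open>G\<close> through \<open>q\<close>.\<close>
    have same: "card (points l') = card (points l)" "S l' = S l"
      using toset_hom_card[OF \<sigma>] by (simp_all add: S_def)
    have "arr F l' (S l) (p l') (arr F l l' \<sigma> s) = arr F l (S l) (p l) s"
      using species_arr_comp[OF assms(1) l S(1)] \<sigma> p l s same by metis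
    moreover have "b (card (points l)) (arr F l (S l) (p l) s) \<in> obj G (S l)"
      using species_arr_in[OF assms(1) l(1) S(1) p[OF l(1)] s] bS bij_betwE by blast
    then have "arr G (S l) l' (q l') (b (card (points l)) (arr F l (S l) (p l) s))
      = arr G l l' \<sigma> (arr G (S l) l (q l) (b (card (points l)) (arr F l (S l) (p l) s)))"
      using species_arr_comp[OF assms(2) S(1) l] \<sigma> q l same by metis
    ultimately show "?\<eta> l' (arr F l l' \<sigma> s) = arr G l l' \<sigma> (?\<eta> l s)"
      by (simp add: same)
  qed
qed


section \<open>Operations on linear species\<close>

text \<open>The identity and the composite appear as variables with their membership in
  \<open>toset_hom\<close> supplied, so that the rigid forms \<open>species_arr_id\<close> and
  \<open>species_arr_comp\<close> match directly.\<close>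

lemma is_speciesI:
  assumes "\<And>l. is_toset l \<Longrightarrow> finite (obj F l)"
    and "\<And>l l' \<sigma> s. is_toset l \<Longrightarrow> is_toset l' \<Longrightarrow> \<sigma> \<in> toset_hom l l' \<Longrightarrow> s \<in> obj F l \<Longrightarrow>
      arr F l l' \<sigma> s \<in> obj F l'"
    and "\<And>l \<sigma> s. is_toset l \<Longrightarrow> \<sigma> = (\<lambda>x\<in>points l. x) \<Longrightarrow> \<sigma> \<in> toset_hom l l \<Longrightarrow>
      s \<in> obj F l \<Longrightarrow> arr F l l \<sigma> s = s"
    and "\<And>l l' l'' \<sigma> \<tau> \<rho> s. is_toset l \<Longrightarrow> is_toset l' \<Longrightarrow> is_toset l'' \<Longrightarrow>
      \<sigma> \<in> toset_hom l l' \<Longrightarrow> \<tau> \<in> toset_hom l' l'' \<Longrightarrow> \<rho> = compose (points l) \<tau> \<sigma> \<Longrightarrow>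
      \<rho> \<in> toset_hom l l'' \<Longrightarrow> s \<in> obj F l \<Longrightarrow>
      arr F l l'' \<rho> s = arr F l' l'' \<tau> (arr F l l' \<sigma> s)"
  shows "is_species F"
  unfolding is_species_def
  by (intro conjI allI impI ballI funcsetI)
    (assumption | rule assms refl toset_hom_id toset_hom_compose)+

lemma is_species_szero: "is_species szero"
  by (rule is_speciesI) (auto simp: szero_def)

lemma is_species_sone: "is_species sone"
  by (rule is_speciesI) (auto simp: sone_def split: if_splits dest: toset_homD(3))

lemma is_species_splus:
  assumes "is_species F" "is_species G"
  shows "is_species (F +\<^sub>S G)"
  by (rule is_speciesI)
    (use assms in \<open>auto simp: splus_def species_finite species_arr_in species_arr_id species_arr_comp\<close>)

text \<open>Once \<open>add_min_map\<close> is known to give morphisms, its compatibility with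
  identities and composition is a consequence of their uniqueness.\<close>

lemma is_species_sderiv:
  assumes "is_species F"
  shows "is_species (sderiv F)"
proof (rule is_speciesI)
  fix l l' l'' :: "'a toset" and \<sigma> \<tau> \<rho> s
  assume "is_toset l" "is_toset l'" "is_toset l''" "\<sigma> \<in> toset_hom l l'" "\<tau> \<in> toset_hom l' l''"
    "\<rho> \<in> toset_hom l l''" "s \<in> obj (sderiv F) l"
  then show "arr (sderiv F) l l'' \<rho> s = arr (sderiv F) l' l'' \<tau> (arr (sderiv F) l l' \<sigma> s)"
    by (auto simp: sderiv_def intro!: species_arr_comp[OF assms, symmetric]
        is_toset_add_min toset_hom_add_min)
qed (use assms in \<open>auto simp: sderiv_def species_finite species_arr_in species_arr_id
      is_toset_add_min toset_hom_add_min\<close>)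

lemma is_species_sint:
  assumes "is_species F"
  shows "is_species (sint F)"
proof (rule is_speciesI)
  fix l l' :: "'a toset" and \<sigma> s
  assume l: "is_toset l" "is_toset l'" and \<sigma>: "\<sigma> \<in> toset_hom l l'" and s: "s \<in> obj (sint F) l"
  \<comment> \<open>An integral has structures only over nonempty sets, and a bijection preserves
    nonemptiness; so minima exist on both sides.\<close>
  then have "points l \<noteq> {}" "points l' \<noteq> {}"
    using toset_homD(3)[OF \<sigma>] by (auto simp: sint_def split: if_splits)
  then show "arr (sint F) l l' \<sigma> s \<in> obj (sint F) l'"
    using species_arr_in[OF assms is_toset_remove_min is_toset_remove_min toset_hom_remove_min] l \<sigma> s
    by (simp add: sint_def)
next
  fix l :: "'a toset" and \<sigma> s
  assume "is_toset l" "\<sigma> \<in> toset_hom l l" "s \<in> obj (sint F) l"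
  then show "arr (sint F) l l \<sigma> s = s"
    using species_arr_id[OF assms is_toset_remove_min toset_hom_remove_min]
    by (simp add: sint_def split: if_splits)
next
  fix l l' l'' :: "'a toset" and \<sigma> \<tau> \<rho> s
  assume *: "is_toset l" "is_toset l'" "is_toset l''" "\<sigma> \<in> toset_hom l l'" "\<tau> \<in> toset_hom l' l''"
    "\<rho> \<in> toset_hom l l''" "s \<in> obj (sint F) l"
  then have "points l \<noteq> {}" "points l' \<noteq> {}" "s \<in> obj F (remove_min l)"
    using toset_homD(3)[OF *(4)] by (auto simp: sint_def split: if_splits)
  then have "arr F (remove_min l') (remove_min l'') (restrict \<tau> (points (remove_min l')))
      (arr F (remove_min l) (remove_min l') (restrict \<sigma> (points (remove_min l))) s)
    = arr F (remove_min l) (remove_min l'') (restrict \<rho> (points (remove_min l))) s"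
    using * by (intro species_arr_comp[OF assms] is_toset_remove_min toset_hom_remove_min)
  then show "arr (sint F) l l'' \<rho> s = arr (sint F) l' l'' \<tau> (arr (sint F) l l' \<sigma> s)"
    by (simp add: sint_def)
qed (use assms in \<open>auto simp: sint_def species_finite is_toset_remove_min\<close>)

text \<open>The second part is the complement of the first, so a decomposition is just a subset. The
  image form, under an injective map, serves finiteness and counting.\<close>

lemma obj_stimes:
  "obj (F *\<^sub>S G) l =
     (\<lambda>(A, s, t). Dec A (fst l |-| A) s t) `
       (SIGMA A : {A. A |\<subseteq>| fst l}. obj F (subtoset l A) \<times> obj G (subtoset l (fst l |-| A)))"
proof -
  have eq: "A |\<union>| B = L \<and> A |\<inter>| B = {||} \<longleftrightarrow> A |\<subseteq>| L \<and> B = L |-| A" for A B L :: "'a univ fset"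
    by auto
  have "obj (F *\<^sub>S G) l = {Dec A B s t | A B s t. (A |\<subseteq>| fst l \<and> B = fst l |-| A) \<and>
      s \<in> obj F (subtoset l A) \<and> t \<in> obj G (subtoset l B)}"
    unfolding eq[symmetric] by (simp add: stimes_def conj_assoc)
  then show ?thesis
    by (auto simp: image_iff)
qed

text \<open>Moves from finite subsets of type \<open>fset\<close> to the ordinary power set, where
  subsets of given size can be counted.\<close>

lemma bij_betw_fset_Pow: "bij_betw fset {A. A |\<subseteq>| S} (Pow (fset S))"
proof -
  have "X \<in> fset ` {A. A |\<subseteq>| S}" if "X \<subseteq> fset S" for X
  proof -
    have "fset (Abs_fset X) = X"
      using that by (simp add: Abs_fset_inverse finite_subset)
    then show ?thesis
      using that by (auto simp: less_eq_fset.rep_eq intro!: rev_image_eqI[of "Abs_fset X"])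
  qed
  then show ?thesis
    by (auto simp: bij_betw_def inj_on_def fset_inject less_eq_fset.rep_eq)
qed

lemma finite_fsubsets: "finite {A. A |\<subseteq>| S}"
  using bij_betw_finite[OF bij_betw_fset_Pow] by simp

lemma toset_hom_decomposition:
  assumes "\<sigma> \<in> toset_hom l l'" "A |\<union>| B = fst l" "A |\<inter>| B = {||}"
  shows "\<sigma> |`| A |\<union>| \<sigma> |`| B = fst l'" "\<sigma> |`| A |\<inter>| \<sigma> |`| B = {||}"
    "fset A \<subseteq> points l" "fset B \<subseteq> points l"
    "fset (\<sigma> |`| A) \<subseteq> points l'" "fset (\<sigma> |`| B) \<subseteq> points l'"
proof -
  have AB: "points l = fset A \<union> fset B" "fset A \<inter> fset B = {}"
    using assms(2,3) by (auto simp: points_def simp flip: assms(2))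
  then show "fset A \<subseteq> points l" "fset B \<subseteq> points l"
    "fset (\<sigma> |`| A) \<subseteq> points l'" "fset (\<sigma> |`| B) \<subseteq> points l'"
    using toset_homD(5)[OF assms(1)] by auto
  show "\<sigma> |`| A |\<union>| \<sigma> |`| B = fst l'"
    using toset_homD(3)[OF assms(1)] AB by (simp add: points_def image_Un flip: fset_inject)
  show "\<sigma> |`| A |\<inter>| \<sigma> |`| B = {||}"
    using inj_on_image_Int[OF toset_homD(2)[OF assms(1)], of "fset A" "fset B"] AB
    by (simp flip: fset_inject)
qed

lemma is_species_stimes:
  assumes F: "is_species F" and G: "is_species G"
  shows "is_species (F *\<^sub>S G)"
proof (rule is_speciesI)
  fix l :: "'a toset" assume l: "is_toset l"
  show "finite (obj (F *\<^sub>S G) l)"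
    unfolding obj_stimes using assms l
    by (intro finite_imageI finite_SigmaI finite_cartesian_product finite_fsubsets)
      (auto intro!: species_finite is_toset_subtoset simp: points_def)
next
  fix l l' :: "'a toset" and \<sigma> u
  assume l: "is_toset l" "is_toset l'" and \<sigma>: "\<sigma> \<in> toset_hom l l'" and u: "u \<in> obj (F *\<^sub>S G) l"
  then obtain A B s t where u_eq: "u = Dec A B s t" and AB: "A |\<union>| B = fst l" "A |\<inter>| B = {||}"
    and s: "s \<in> obj F (subtoset l A)" and t: "t \<in> obj G (subtoset l B)"
    by (auto simp: stimes_def)
  note im = toset_hom_decomposition[OF \<sigma> AB]
  have "arr F (subtoset l A) (subtoset l' (\<sigma> |`| A)) (restrict \<sigma> (fset A)) s
      \<in> obj F (subtoset l' (\<sigma> |`| A))"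
    by (intro species_arr_in[OF F] is_toset_subtoset toset_hom_restrict \<sigma> l s im)
  moreover have "arr G (subtoset l B) (subtoset l' (\<sigma> |`| B)) (restrict \<sigma> (fset B)) t
      \<in> obj G (subtoset l' (\<sigma> |`| B))"
    by (intro species_arr_in[OF G] is_toset_subtoset toset_hom_restrict \<sigma> l t im)
  ultimately show "arr (F *\<^sub>S G) l l' \<sigma> u \<in> obj (F *\<^sub>S G) l'"
    using im(1,2) by (simp add: u_eq stimes_def)
next
  fix l :: "'a toset" and \<sigma> u
  assume l: "is_toset l" and \<sigma>: "\<sigma> = (\<lambda>x\<in>points l. x)" "\<sigma> \<in> toset_hom l l"
    and u: "u \<in> obj (F *\<^sub>S G) l"
  then obtain A B s t where u_eq: "u = Dec A B s t" and AB: "A |\<union>| B = fst l" "A |\<inter>| B = {||}"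
    and s: "s \<in> obj F (subtoset l A)" and t: "t \<in> obj G (subtoset l B)"
    by (auto simp: stimes_def)
  note im = toset_hom_decomposition[OF \<sigma>(2) AB]
  have id: "\<sigma> |`| C = C" if "fset C \<subseteq> points l" for C
    using that by (auto simp: \<sigma>(1) fset_eq_iff image_iff subset_iff)
  have hom: "restrict \<sigma> (fset C) \<in> toset_hom (subtoset l C) (subtoset l C)"
    if "fset C \<subseteq> points l" for C
    using toset_hom_restrict[OF \<sigma>(2) that] id[OF that] by simp
  have "arr F (subtoset l A) (subtoset l A) (restrict \<sigma> (fset A)) s = s"
    by (intro species_arr_id[OF F] is_toset_subtoset hom l s im)
  moreover have "arr G (subtoset l B) (subtoset l B) (restrict \<sigma> (fset B)) t = t"
    by (intro species_arr_id[OF G] is_toset_subtoset hom l t im)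
  ultimately show "arr (F *\<^sub>S G) l l \<sigma> u = u"
    by (simp add: u_eq stimes_def id im)
next
  fix l l' l'' :: "'a toset" and \<sigma> \<tau> \<rho> u
  assume l: "is_toset l" "is_toset l'" "is_toset l''"
    and \<sigma>: "\<sigma> \<in> toset_hom l l'" and \<tau>: "\<tau> \<in> toset_hom l' l''"
    and \<rho>: "\<rho> = compose (points l) \<tau> \<sigma>" "\<rho> \<in> toset_hom l l''" and u: "u \<in> obj (F *\<^sub>S G) l"
  then obtain A B s t where u_eq: "u = Dec A B s t" and AB: "A |\<union>| B = fst l" "A |\<inter>| B = {||}"
    and s: "s \<in> obj F (subtoset l A)" and t: "t \<in> obj G (subtoset l B)"
    by (auto simp: stimes_def)
  note im = toset_hom_decomposition[OF \<sigma> AB]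
  note im' = toset_hom_decomposition[OF \<tau> im(1,2)]
  \<comment> \<open>The two parts of a decomposition are plain sets, so their images must be
    compared directly; only then do the structures on them form triangles covered by
    rigidity.\<close>
  have \<rho>_image: "\<rho> |`| C = \<tau> |`| \<sigma> |`| C" if "fset C \<subseteq> points l" for C
    using that by (auto simp: \<rho>(1) compose_def image_image subset_iff simp flip: fset_inject intro!: image_cong)
  have hom: "restrict \<rho> (fset C) \<in> toset_hom (subtoset l C) (subtoset l'' (\<tau> |`| \<sigma> |`| C))"
    if "fset C \<subseteq> points l" for C
    using toset_hom_restrict[OF \<rho>(2) that] \<rho>_image[OF that] by simp
  have "arr F (subtoset l' (\<sigma> |`| A)) (subtoset l'' (\<tau> |`| \<sigma> |`| A)) (restrict \<tau> (fset (\<sigma> |`| A)))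
      (arr F (subtoset l A) (subtoset l' (\<sigma> |`| A)) (restrict \<sigma> (fset A)) s)
    = arr F (subtoset l A) (subtoset l'' (\<tau> |`| \<sigma> |`| A)) (restrict \<rho> (fset A)) s"
    by (intro species_arr_comp[OF F] is_toset_subtoset toset_hom_restrict hom \<sigma> \<tau> l s im im')
  moreover have "arr G (subtoset l' (\<sigma> |`| B)) (subtoset l'' (\<tau> |`| \<sigma> |`| B)) (restrict \<tau> (fset (\<sigma> |`| B)))
      (arr G (subtoset l B) (subtoset l' (\<sigma> |`| B)) (restrict \<sigma> (fset B)) t)
    = arr G (subtoset l B) (subtoset l'' (\<tau> |`| \<sigma> |`| B)) (restrict \<rho> (fset B)) t"
    by (intro species_arr_comp[OF G] is_toset_subtoset toset_hom_restrict hom \<sigma> \<tau> l t im im')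
  ultimately show "arr (F *\<^sub>S G) l l'' \<rho> u = arr (F *\<^sub>S G) l' l'' \<tau> (arr (F *\<^sub>S G) l l' \<sigma> u)"
    by (simp add: u_eq stimes_def \<rho>_image im)
qed

section \<open>Counting structures\<close>

lemma scard_szero [simp]: "scard szero n = 0"
  by (simp add: scard_def szero_def)

lemma scard_sone: "scard sone n = (if n = 0 then 1 else 0)"
  by (simp add: scard_def sone_def points_std_empty_iff)

lemma scard_splus:
  assumes "is_species F" "is_species G"
  shows "scard (F +\<^sub>S G) n = scard F n + scard G n"
  unfolding scard_def splus_def species.simps
  by (subst card_Un_disjoint) (auto simp: card_image inj_on_def species_finite assms)

lemma scard_sderiv: "scard (sderiv F) n = scard F (Suc n)"
  by (simp add: scard_def sderiv_def)

lemma scard_sint: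
  assumes "is_species F"
  shows "scard (sint F) n = (case n of 0 \<Rightarrow> 0 | Suc m \<Rightarrow> scard F m)"
proof (cases n)
  case 0
  then show ?thesis
    by (simp add: scard_def sint_def points_def)
next
  case (Suc m)
  then have n: "points (std_toset n :: 'a toset) \<noteq> {}"
    by (simp add: points_std_empty_iff del: std_toset.simps)
  then have "scard (sint F) n = card (obj F (remove_min (std_toset n)))"
    by (simp add: scard_def sint_def)
  also have "\<dots> = scard F (card (points (remove_min (std_toset n :: 'a toset))))"
    by (intro card_obj[OF assms] is_toset_remove_min is_toset_std)
  also have "\<dots> = scard F m"
    using n by (simp add: card_points_remove_min Suc del: std_toset.simps)
  finally show ?thesis
    by (simp add: Suc)
qed

text \<open>Groups the subsets by cardinality; each size k occurs binomially often.\<close>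

lemma sum_card_subsets:
  assumes "finite S"
  shows "(\<Sum>A\<in>Pow S. f (card A)) = (\<Sum>k\<le>card S. of_nat (card S choose k) * (f k :: 'b :: semiring_1))"
proof -
  have "(\<Sum>A\<in>Pow S. f (card A)) = (\<Sum>k\<le>card S. \<Sum>A\<in>{A \<in> Pow S. card A = k}. f (card A))"
    using assms by (intro sum.group[symmetric]) (auto intro: card_mono)
  also have "\<dots> = (\<Sum>k\<le>card S. of_nat (card S choose k) * f k)"
    using n_subsets[OF assms] by (intro sum.cong) (auto simp: Pow_def)
  finally show ?thesis .
qed

text \<open>By \<open>card_obj\<close>, the number of structures on a decomposition depends only on
  the size of its first part, which may be any subset of the labels.\<close>

lemma scard_stimes:
  assumes F: "is_species F" and G: "is_species G"
  shows "scard (F *\<^sub>S G) n = (\<Sum>k\<le>n. (n choose k) * (scard F k * scard G (n - k)))"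
proof -
  let ?l = "std_toset n :: 'a toset"
  let ?S = "{A. A |\<subseteq>| fst ?l}"
  have card_l: "card (fset (fst ?l)) = n"
    using card_std[of n] by (simp add: points_def)
  have sub: "is_toset (subtoset ?l A)" if "A |\<subseteq>| fst ?l" for A
    using that by (auto intro!: is_toset_subtoset simp: points_def)
  have "scard (F *\<^sub>S G) n
      = card (SIGMA A : ?S. obj F (subtoset ?l A) \<times> obj G (subtoset ?l (fst ?l |-| A)))"
    unfolding scard_def obj_stimes by (intro card_image) (auto simp: inj_on_def)
  also have "\<dots> = (\<Sum>A\<in>?S. card (obj F (subtoset ?l A) \<times> obj G (subtoset ?l (fst ?l |-| A))))"
    using sub by (intro card_SigmaI finite_fsubsets) (auto intro!: species_finite[OF F] species_finite[OF G])
  also have "\<dots> = (\<Sum>A\<in>?S. scard F (card (fset A)) * scard G (n - card (fset A)))"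
    using sub card_l
    by (intro sum.cong refl)
      (auto simp: card_cartesian_product card_obj[OF F] card_obj[OF G] card_Diff_subset
        less_eq_fset.rep_eq)
  also have "\<dots> = (\<Sum>A\<in>Pow (fset (fst ?l)). scard F (card A) * scard G (n - card A))"
    by (rule sum.reindex_bij_betw[OF bij_betw_fset_Pow])
  also have "\<dots> = (\<Sum>k\<le>n. (n choose k) * (scard F k * scard G (n - k)))"
    by (subst sum_card_subsets) (simp_all add: card_l)
  finally show ?thesis .
qed


section \<open>Exponential generating series\<close>

definition egf :: "'a species \<Rightarrow> rat fps" where
  "egf F = Abs_fps (\<lambda>n. of_nat (scard F n) / fact n)"

lemma egf_nth: "fps_nth (egf F) n = of_nat (scard F n) / fact n"
  by (simp add: egf_def)

lemma egf_eq_iff: "egf F = egf G \<longleftrightarrow> scard F = scard G"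
  by (simp add: fps_eq_iff egf_nth fun_eq_iff)

lemma egf_szero: "egf szero = 0"
  by (simp add: fps_eq_iff egf_nth)

lemma egf_sone: "egf sone = 1"
  by (simp add: fps_eq_iff egf_nth scard_sone)

lemma egf_splus: "is_species F \<Longrightarrow> is_species G \<Longrightarrow> egf (F +\<^sub>S G) = egf F + egf G"
  by (simp add: fps_eq_iff egf_nth scard_splus add_divide_distrib)

lemma egf_stimes:
  assumes "is_species F" "is_species G"
  shows "egf (F *\<^sub>S G) = egf F * egf G"
proof (rule fps_ext)
  fix n
  have "fps_nth (egf (F *\<^sub>S G)) n = (\<Sum>k\<le>n. of_nat (n choose k) * (of_nat (scard F k) * of_nat (scard G (n - k))) / fact n)"
    by (simp add: egf_nth scard_stimes assms sum_divide_distrib)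
  also have "\<dots> = (\<Sum>k\<le>n. fps_nth (egf F) k * fps_nth (egf G) (n - k))"
    \<comment> \<open>The binomial coefficient over n! is 1 / (k! (n - k)!), one factorial for each
      factor.\<close>
    by (intro sum.cong refl) (simp add: binomial_fact egf_nth)
  finally show "fps_nth (egf (F *\<^sub>S G)) n = fps_nth (egf F * egf G) n"
    by (simp add: fps_mult_nth atMost_atLeast0)
qed

lemma egf_sderiv: "egf (sderiv F) = fps_deriv (egf F)"
  by (simp add: fps_eq_iff egf_nth scard_sderiv del: of_nat_Suc flip: Suc_eq_plus1)

text \<open>The absence of structures over the empty set is the zero integration constant; in degree
  m + 1 the denominator m! gains the factor m + 1.\<close>

lemma egf_sint: "is_species F \<Longrightarrow> egf (sint F) = fps_integral0 (egf F)"
  by (auto simp: fps_eq_iff egf_nth scard_sint fps_integral_def divide_inverse split: nat.splits simp del: of_nat_Suc)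

lemma fps_integral0_by_parts:
  fixes f g :: "'b :: field_char_0 fps"
  shows "fps_integral0 (fps_deriv f * fps_integral0 g) = f * fps_integral0 g - fps_integral0 (f * g)"
proof -
  have "f * fps_integral0 g = fps_integral0 (fps_deriv (f * fps_integral0 g))"
    \<comment> \<open>Integrating a derivative loses the constant term, which is zero here because
      of the factor \<open>fps_integral0 g\<close>.\<close>
    by (subst fps_integral0_deriv) simp
  also have "\<dots> = fps_integral0 (f * g) + fps_integral0 (fps_deriv f * fps_integral0 g)"
    by (simp add: fps_deriv_fps_integral fps_integral0_add)
  finally show ?thesis
    by (simp add: algebra_simps)
qed


section \<open>The ring of virtual linear species\<close>

text \<open>The isomorphism of cross sums is an equation of series, where subtraction is available;
  this cancellation makes transitivity of the relation immediate.\<close>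

lemma virtual_rel_iff:
  "((F, G), (H, K)) \<in> virtual_rel \<longleftrightarrow>
     is_species F \<and> is_species G \<and> is_species H \<and> is_species K \<and> egf F - egf G = egf H - egf K"
proof -
  have "F +\<^sub>S K \<cong>\<^sub>S G +\<^sub>S H \<longleftrightarrow> egf F - egf G = egf H - egf K"
    if "is_species F" "is_species G" "is_species H" "is_species K"
  proof -
    have "F +\<^sub>S K \<cong>\<^sub>S G +\<^sub>S H \<longleftrightarrow> egf F + egf K = egf G + egf H"
      using that by (simp add: species_iso_iff_scard is_species_splus egf_splus flip: egf_eq_iff)
    then show ?thesis
      by (simp add: algebra_simps)
  qed
  then show ?thesis
    by (auto simp: virtual_rel_def)
qed

lemma equiv_virtual_rel: "equiv ({F. is_species F} \<times> {G. is_species G}) virtual_rel"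
  by (intro equivI refl_onI symI transI) (auto simp: virtual_rel_iff)

text \<open>The choice of representative is harmless: by \<open>virtual_rel_iff\<close> all members
  of a class have the same difference of series.\<close>

definition vegf :: "'a virtual \<Rightarrow> rat fps" where
  "vegf X = (case SOME p. p \<in> X of (F, G) \<Rightarrow> egf F - egf G)"

lemma vegf_vdiff:
  assumes "is_species F" "is_species G"
  shows "vegf (vdiff F G) = egf F - egf G"
proof -
  have "(F, G) \<in> vdiff F G"
    using assms by (simp add: vdiff_def virtual_rel_iff)
  then have "(SOME p. p \<in> vdiff F G) \<in> vdiff F G"
    by (rule someI)
  then show ?thesis
    by (auto simp: vegf_def vdiff_def virtual_rel_iff split: prod.splits)
qed

lemma vdiff_eq_iff:
  assumes "is_species F" "is_species G" "is_species H" "is_species K"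
  shows "vdiff F G = vdiff H K \<longleftrightarrow> egf F - egf G = egf H - egf K"
  unfolding vdiff_def using assms
  by (subst eq_equiv_class_iff[OF equiv_virtual_rel]) (simp_all add: virtual_rel_iff)

lemma vdiff_in_carrier: "is_species F \<Longrightarrow> is_species G \<Longrightarrow> vdiff F G \<in> carrier LVir"
  by (simp add: LVir_def vdiff_def quotientI)

lemma carrier_LVirE:
  assumes "X \<in> carrier LVir"
  obtains F G where "is_species F" "is_species G" "X = vdiff F G"
  using assms by (auto simp: LVir_def vdiff_def elim!: quotientE)

lemma inj_on_vegf: "inj_on vegf (carrier LVir)"
  by (intro inj_onI; elim carrier_LVirE) (simp add: vegf_vdiff vdiff_eq_iff)

text \<open>A class is nonempty, and a constant family over a nonempty index set has that constant
  as its union. The third assumption is independence of the representative.\<close>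

lemma UN_vdiff:
  assumes "is_species F" "is_species G"
    and "\<And>F' G'. is_species F' \<Longrightarrow> is_species G' \<Longrightarrow> egf F' - egf G' = egf F - egf G \<Longrightarrow> f F' G' = f F G"
  shows "(\<Union>(F', G')\<in>vdiff F G. f F' G') = f F G"
proof -
  have "(F, G) \<in> vdiff F G"
    using assms(1,2) by (simp add: vdiff_def virtual_rel_iff)
  then have "vdiff F G \<noteq> {}"
    by auto
  moreover have "(case p of (F', G') \<Rightarrow> f F' G') = f F G" if "p \<in> vdiff F G" for p
    using that assms(3)[of "fst p" "snd p"] by (cases p) (simp add: vdiff_def virtual_rel_iff)
  ultimately show ?thesis
    by (rule SUP_eq_const)
qed

lemma vdiff_add:
  assumes "is_species F" "is_species G" "is_species H" "is_species K"
  shows "vdiff F G \<oplus>\<^bsub>LVir\<^esub> vdiff H K = vdiff (F +\<^sub>S H) (G +\<^sub>S K)"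
proof -
  \<comment> \<open>The inner union is collapsed for every representative of the first class, so
    that the outer family can then be seen to be constant.\<close>
  have "(\<Union>(H', K')\<in>vdiff H K. vdiff (F' +\<^sub>S H') (G' +\<^sub>S K')) = vdiff (F' +\<^sub>S H) (G' +\<^sub>S K)"
    if "is_species F'" "is_species G'" for F' G'
    using assms that
    by (intro UN_vdiff) (simp_all add: vdiff_eq_iff is_species_splus egf_splus algebra_simps)
  moreover have "(\<Union>(F', G')\<in>vdiff F G. \<Union>(H', K')\<in>vdiff H K. vdiff (F' +\<^sub>S H') (G' +\<^sub>S K'))
      = (\<Union>(H', K')\<in>vdiff H K. vdiff (F +\<^sub>S H') (G +\<^sub>S K'))"
    using assms calculation
    by (intro UN_vdiff) (simp_all add: vdiff_eq_iff is_species_splus egf_splus algebra_simps)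
  ultimately show ?thesis
    using assms by (simp add: LVir_def)
qed

lemma vdiff_mult:
  assumes "is_species F" "is_species G" "is_species H" "is_species K"
  shows "vdiff F G \<otimes>\<^bsub>LVir\<^esub> vdiff H K = vdiff (F *\<^sub>S H +\<^sub>S G *\<^sub>S K) (F *\<^sub>S K +\<^sub>S G *\<^sub>S H)"
proof -
  let ?m = "\<lambda>F G H K. vdiff (F *\<^sub>S H +\<^sub>S G *\<^sub>S K) (F *\<^sub>S K +\<^sub>S G *\<^sub>S H)"
  have m: "?m F G H K = ?m F' G' H' K'"
    if "is_species F" "is_species G" "is_species H" "is_species K"
      "is_species F'" "is_species G'" "is_species H'" "is_species K'"
      "egf F - egf G = egf F' - egf G'" "egf H - egf K = egf H' - egf K'"
    for F G H K F' G' H' K'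
  proof -
    \<comment> \<open>Expanding (f - g)(h - k) gives exactly the difference of the two species
      series in \<open>?m\<close>, so the product class depends only on the two differences.\<close>
    have "(egf F - egf G) * (egf H - egf K) = (egf F' - egf G') * (egf H' - egf K')"
      using that by simp
    with that show ?thesis
      by (simp add: vdiff_eq_iff is_species_splus is_species_stimes egf_splus egf_stimes algebra_simps)
  qed
  have inner: "(\<Union>(H', K')\<in>vdiff H K. ?m F' G' H' K') = ?m F' G' H K"
    if "is_species F'" "is_species G'" for F' G'
    using assms that by (intro UN_vdiff m) simp_all
  have "(\<Union>(F', G')\<in>vdiff F G. \<Union>(H', K')\<in>vdiff H K. ?m F' G' H' K')
      = (\<Union>(H', K')\<in>vdiff H K. ?m F G H' K')"
    by (intro UN_vdiff; simp only: assms inner; rule m; simp add: assms)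
  then show ?thesis
    using assms by (simp add: LVir_def inner)
qed

lemma vderiv_vdiff:
  assumes "is_species F" "is_species G"
  shows "vderiv (vdiff F G) = vdiff (sderiv F) (sderiv G)"
  unfolding vderiv_def using assms
  by (intro UN_vdiff) (simp_all add: vdiff_eq_iff is_species_sderiv egf_sderiv flip: fps_deriv_sub)

lemma vint_vdiff:
  assumes "is_species F" "is_species G"
  shows "vint (vdiff F G) = vdiff (sint F) (sint G)"
  unfolding vint_def using assms
  by (intro UN_vdiff) (simp_all add: vdiff_eq_iff is_species_sint egf_sint flip: fps_integral0_sub)

text \<open>This contains well-definedness: the union over representatives has already been
  identified with a single class.\<close>

lemma LVir_closed:
  assumes "X \<in> carrier LVir" "Y \<in> carrier LVir"
  shows "X \<oplus>\<^bsub>LVir\<^esub> Y \<in> carrier LVir" "X \<otimes>\<^bsub>LVir\<^esub> Y \<in> carrier LVir"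
    "vderiv X \<in> carrier LVir" "vint X \<in> carrier LVir"
  using assms
  by (auto elim!: carrier_LVirE simp: vdiff_add vdiff_mult vderiv_vdiff vint_vdiff
      intro!: vdiff_in_carrier is_species_splus is_species_stimes is_species_sderiv is_species_sint)

lemma LVir_zero_one_closed: "\<zero>\<^bsub>LVir\<^esub> \<in> carrier LVir" "\<one>\<^bsub>LVir\<^esub> \<in> carrier LVir"
  using vdiff_in_carrier[OF is_species_szero is_species_szero]
    vdiff_in_carrier[OF is_species_sone is_species_szero]
  by (simp_all add: LVir_def)

lemma vegf_zero_one: "vegf \<zero>\<^bsub>LVir\<^esub> = 0" "vegf \<one>\<^bsub>LVir\<^esub> = 1"
  by (simp_all add: LVir_def vegf_vdiff is_species_szero is_species_sone egf_szero egf_sone)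

text \<open>Together with \<open>inj_on_vegf\<close>, this lets every equation between virtual
  species be checked on power series.\<close>

lemma vegf_hom:
  assumes "X \<in> carrier LVir" "Y \<in> carrier LVir"
  shows "vegf (X \<oplus>\<^bsub>LVir\<^esub> Y) = vegf X + vegf Y" "vegf (X \<otimes>\<^bsub>LVir\<^esub> Y) = vegf X * vegf Y"
    "vegf (vderiv X) = fps_deriv (vegf X)" "vegf (vint X) = fps_integral0 (vegf X)"
  using assms
  by (auto elim!: carrier_LVirE simp: vdiff_add vdiff_mult vderiv_vdiff vint_vdiff vegf_vdiff
      is_species_splus is_species_stimes is_species_sderiv is_species_sint
      egf_splus egf_stimes egf_sderiv egf_sint fps_integral0_sub algebra_simps)

lemma LVir_eqI:
  "vegf X = vegf Y \<Longrightarrow> X \<in> carrier LVir \<Longrightarrow> Y \<in> carrier LVir \<Longrightarrow> X = Y"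
  using inj_on_vegf by (rule inj_onD)

text \<open>Existence does not pull back along an embedding that is not onto; the witness is the
  formal difference with its two species exchanged.\<close>

lemma LVir_negative:
  assumes "X \<in> carrier LVir"
  shows "\<exists>Y\<in>carrier LVir. Y \<oplus>\<^bsub>LVir\<^esub> X = \<zero>\<^bsub>LVir\<^esub>"
proof -
  obtain F G where X: "is_species F" "is_species G" "X = vdiff F G"
    using assms by (rule carrier_LVirE)
  then have "vdiff G F \<in> carrier LVir"
    by (simp add: vdiff_in_carrier)
  moreover from this X assms have "vdiff G F \<oplus>\<^bsub>LVir\<^esub> X = \<zero>\<^bsub>LVir\<^esub>"
    by (intro LVir_eqI) (simp_all add: vegf_hom vegf_zero_one LVir_closed LVir_zero_one_closed vegf_vdiff)
  ultimately show ?thesis ..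
qed

lemma cring_LVir: "cring LVir"
  by (intro cringI abelian_groupI comm_monoidI)
    ((simp add: LVir_closed LVir_zero_one_closed; fail) | rule LVir_negative, assumption |
      (rule LVir_eqI;
        simp add: LVir_closed LVir_zero_one_closed vegf_hom vegf_zero_one algebra_simps))+

theorem theorem2p37:
  shows "integro_differential_ring (LVir :: 'a virtual ring) vderiv vint"
proof -
  interpret cring "LVir :: 'a virtual ring"
    by (rule cring_LVir)
  \<comment> \<open>Subtraction in \<open>LVir\<close> uses the abstract additive inverse, so its
    series is obtained by cancelling \<open>Y\<close> from (X - Y) + Y = X.\<close>
  have vegf_minus: "vegf (X \<ominus>\<^bsub>LVir\<^esub> Y) = vegf X - vegf Y"
    if "X \<in> carrier LVir" "Y \<in> carrier LVir" for X Y :: "'a virtual"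
  proof -
    have "vegf (X \<ominus>\<^bsub>LVir\<^esub> Y) + vegf Y = vegf ((X \<ominus>\<^bsub>LVir\<^esub> Y) \<oplus>\<^bsub>LVir\<^esub> Y)"
      using that by (simp add: vegf_hom)
    also have "(X \<ominus>\<^bsub>LVir\<^esub> Y) \<oplus>\<^bsub>LVir\<^esub> Y = X"
      using that by (simp add: a_minus_def a_assoc l_neg)
    finally show ?thesis
      by (simp add: algebra_simps)
  qed
  show ?thesis
    \<comment> \<open>Closure is known already; each remaining axiom is an equation, transferred to
      power series by \<open>LVir_eqI\<close>.\<close>
    by unfold_locales
      ((simp add: LVir_closed; fail) |
        (rule LVir_eqI; simp add: LVir_closed vegf_hom vegf_minus fps_integral0_add
          fps_deriv_fps_integral fps_integral0_by_parts algebra_simps))+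
qed

end
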